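(* Let $S\subset\mathbb{R}^2$ be a path-connected set. Then $S$ is closed and ortho-convex if and only if $S$ is the intersection of a family of staircase-halfplanes.
   Context: A set in $\mathbb{R}^2$ is ortho-convex if its intersection with every horizontal line and every vertical line is connected (possibly empty). An axis-aligned segment is a line segment parallel to one of the coordinate axes. A staircase segment is a simple polyline $v_0v_1\ldots v_n$ in $\mathbb{R}^2$ formed by axis-aligned segments such that all vectors $\overrightarrow{v_{i-1}v_i}$ with $i$ odd have the same direction, and all vectors $\overrightarrow{v_{i-1}v_i}$ with $i$ even have the same direction ($1\le i\le n$). A staircase line is a path obtained from a staircase segment $v_0v_1\ldots v_n$ by replacing the line segments $v_0v_1$ and $v_{n-1}v_n$ with the ray from $v_1$ through $v_0$ and the ray from $v_{n-1}$ through $v_n$, respectively; in particular axis-aligned lines are staircase lines. A staircase-halfplane is a closed set whose boundary is a staircase line; the two staircase-halfplanes formed by a staircase line $l$ are the closures of the two connected components of $\mathbb{R}^2\setminus l$. The intersection of the empty family is understood to be $\mathbb{R}^2$. *)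

theory Defs
  imports "HOL-Analysis.Analysis"
begin

type_synonym point = "real \<times> real"

definition ortho_convex :: "point set \<Rightarrow> bool" where
  "ortho_convex S \<longleftrightarrow>
     (\<forall>c. connected (S \<inter> {p. fst p = c}) \<and> connected (S \<inter> {p. snd p = c}))"

definition axis_aligned :: "point \<Rightarrow> point \<Rightarrow> bool" where
  "axis_aligned a b \<longleftrightarrow> fst a = fst b \<or> snd a = snd b"

definition same_direction :: "point \<Rightarrow> point \<Rightarrow> bool" where
  "same_direction u w \<longleftrightarrow> u \<noteq> 0 \<and> (\<exists>c>0. w = c *\<^sub>R u)"

(* The polyline v 0, v 1, ..., v n; the values v i for i > n are irrelevant. *)
definition simple_polyline :: "(nat \<Rightarrow> point) \<Rightarrow> nat \<Rightarrow> bool" where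
  "simple_polyline v n \<longleftrightarrow>
     (\<forall>i<n. v i \<noteq> v (Suc i)) \<and>
     (\<forall>j<n. \<forall>i<j. closed_segment (v i) (v (Suc i)) \<inter> closed_segment (v j) (v (Suc j))
                     = (if j = Suc i then {v j} else {}))"

(* The two directions (for odd and for even i) may coincide: the polyline is then straight. *)
definition staircase_segment :: "(nat \<Rightarrow> point) \<Rightarrow> nat \<Rightarrow> bool" where
  "staircase_segment v n \<longleftrightarrow>
     1 \<le> n \<and> simple_polyline v n \<and>
     (\<forall>i\<in>{1..n}. axis_aligned (v (i - 1)) (v i)) \<and>
     (\<forall>i\<in>{1..n}. \<forall>j\<in>{1..n}. odd i \<and> odd j \<longrightarrow>
        same_direction (v i - v (i - 1)) (v j - v (j - 1))) \<and>
     (\<forall>i\<in>{1..n}. \<forall>j\<in>{1..n}. even i \<and> even j \<longrightarrow>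
        same_direction (v i - v (i - 1)) (v j - v (j - 1)))"

(* The ray from a through b. *)
definition ray :: "point \<Rightarrow> point \<Rightarrow> point set" where
  "ray a b = (\<lambda>t. a + t *\<^sub>R (b - a)) ` {0..}"

(* For n = 1 the two rays make up the full line through v 0 and v 1. *)
definition staircase_line :: "point set \<Rightarrow> bool" where
  "staircase_line l \<longleftrightarrow>
     (\<exists>v n. staircase_segment v n \<and>
        l = ray (v 1) (v 0) \<union> (\<Union>i\<in>{1<..<n}. closed_segment (v (i - 1)) (v i))
              \<union> ray (v (n - 1)) (v n))"

(* The condition on components excludes the case where H is the staircase line itself,
   which is also a closed set with boundary a staircase line. *)
definition staircase_halfplane :: "point set \<Rightarrow> bool" where
  "staircase_halfplane H \<longleftrightarrow>
     closed H \<and> staircase_line (frontier H) \<and> H \<in> closure ` components (- frontier H)"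

end

theory Submission
  imports Defs
begin

text \<open>
  From left to right, a point \<open>p\<close> outside \<open>S\<close> has to be cut off from \<open>S\<close> by a staircase-halfplane.
  Complements of open quadrants, whose boundary is a single right-angled bend, already suffice,
  so the task is to find an open quadrant that contains \<open>p\<close> and misses \<open>S\<close>.
  Take a square around \<open>p\<close> that misses the closed set \<open>S\<close>, and extend it to a
  horizontal and a vertical strip. In each strip \<open>S\<close> lies on one side of the square only
  (\<open>one_sided_horizontal_strip\<close>): if \<open>S\<close> reached the horizontal strip on both sides, a connection
  between the two parts would have to pass above or below the square and, on the way, would put
  points on both sides of the square on one horizontal line, against ortho-convexity.
  If, say, \<open>S\<close> lies to the right of the square in one strip and above it in the other, then the boundary of
  the lower left quadrant at a point slightly above and to the right of \<open>p\<close> misses \<open>S\<close>.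
  Since \<open>S\<close> is connected, it either misses that quadrant, which contains \<open>p\<close>, or it lies inside it;
  in the second case \<open>S\<close> misses the upper right quadrant at a point slightly below and to the left
  of \<open>p\<close> (\<open>separating_quadrant\<close>).

  From right to left, closedness and ortho-convexity are preserved by intersections, so only a single
  staircase-halfplane has to be shown ortho-convex. A staircase line is monotone, say
  ascending: of any two of its points one is above and to the right of the other. It is also
  connected and runs off to infinity at both ends, so it meets every descending diagonal
  (\<open>staircase_line_structure\<close>). In coordinates along and across the ascending diagonal it is therefore
  the graph of a function with Lipschitz constant 1. Each component of the complement lies on one side
  of this graph, and steps to the right or downwards (or, on the other side, to the left or upwards)
  do not leave that side. Hence the component and its closure are closed under such steps,
  and a set with this property meets every horizontal or vertical line
  in a half-line, in the whole line or not at all (\<open>ortho_convex_closure_component\<close>).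
\<close>

section \<open>Ortho-convexity in terms of intervals\<close>

lemma ortho_convex_iff_intervals:
  "ortho_convex S \<longleftrightarrow>
     (\<forall>y. is_interval {x. (x, y) \<in> S}) \<and> (\<forall>x. is_interval {y. (x, y) \<in> S})"
proof -
  have hor: "connected (S \<inter> {p. snd p = y}) \<longleftrightarrow> is_interval {x. (x, y) \<in> S}" for y
  proof -
    have eq: "S \<inter> {p. snd p = y} = (\<lambda>x. (x, y)) ` {x. (x, y) \<in> S}"
        "{x. (x, y) \<in> S} = fst ` (S \<inter> {p. snd p = y})"
      by force+
    have "connected ((\<lambda>x. (x, y)) ` I)" if "connected I" for I :: "real set"
      by (intro connected_continuous_image that continuous_intros)
    moreover have "connected (fst ` A)" if "connected A" for A :: "point set"
      by (intro connected_continuous_image that continuous_intros)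
    ultimately show ?thesis
      unfolding is_interval_connected_1 by (metis eq)
  qed
  have ver: "connected (S \<inter> {p. fst p = x}) \<longleftrightarrow> is_interval {y. (x, y) \<in> S}" for x
  proof -
    have eq: "S \<inter> {p. fst p = x} = Pair x ` {y. (x, y) \<in> S}"
        "{y. (x, y) \<in> S} = snd ` (S \<inter> {p. fst p = x})"
      by force+
    have "connected (Pair x ` I)" if "connected I" for I :: "real set"
      by (intro connected_continuous_image that continuous_intros)
    moreover have "connected (snd ` A)" if "connected A" for A :: "point set"
      by (intro connected_continuous_image that continuous_intros)
    ultimately show ?thesis
      unfolding is_interval_connected_1 by (metis eq)
  qed
  show ?thesis
    unfolding ortho_convex_def hor ver by blast
qed

lemma ortho_convex_horizontalD:
  assumes "ortho_convex S" "(x1, y) \<in> S" "(x2, y) \<in> S" "x1 \<le> x" "x \<le> x2"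
  shows "(x, y) \<in> S"
  using assms unfolding ortho_convex_iff_intervals is_interval_1 by blast

lemma ortho_convex_verticalD:
  assumes "ortho_convex S" "(x, y1) \<in> S" "(x, y2) \<in> S" "y1 \<le> y" "y \<le> y2"
  shows "(x, y) \<in> S"
  using assms unfolding ortho_convex_iff_intervals is_interval_1 by blast

lemma ortho_convex_Inter:
  assumes "\<And>H. H \<in> \<F> \<Longrightarrow> ortho_convex H"
  shows "ortho_convex (\<Inter>\<F>)"
  using assms unfolding ortho_convex_iff_intervals is_interval_1 by blast

lemma ortho_convex_swap:
  assumes "ortho_convex S"
  shows "ortho_convex (prod.swap ` S)"
  using assms unfolding ortho_convex_iff_intervals by simp

section \<open>Complements of quadrants as staircase-halfplanes\<close>

text \<open>
  Only the signs of \<open>\<sigma>\<close> and \<open>\<tau>\<close> matter; as parameters they let one argument treat all four quadrants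
  at \<open>q\<close>.
\<close>

definition quadrant :: "real \<Rightarrow> real \<Rightarrow> point \<Rightarrow> point set" where
  "quadrant \<sigma> \<tau> q = {p. 0 < \<sigma> * (fst p - fst q) \<and> 0 < \<tau> * (snd p - snd q)}"

lemma open_quadrant: "open (quadrant \<sigma> \<tau> q)"
  unfolding quadrant_def
  by (intro open_Collect_conj open_Collect_less continuous_intros)

text \<open>
  The complement of the closed quadrant: \<open>quadrant\<close> and \<open>outer\<close> are the two sides of the bend that
  bounds the quadrant.
\<close>

definition outer :: "real \<Rightarrow> real \<Rightarrow> point \<Rightarrow> point set" where
  "outer \<sigma> \<tau> q = {p. \<sigma> * (fst p - fst q) < 0 \<or> \<tau> * (snd p - snd q) < 0}"

lemma open_outer: "open (outer \<sigma> \<tau> q)"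
  unfolding outer_def
  by (intro open_Collect_disj open_Collect_less continuous_intros)

lemma quadrant_outer_disjoint: "quadrant \<sigma> \<tau> q \<inter> outer \<sigma> \<tau> q = {}"
  by (auto simp: quadrant_def outer_def)

lemma connected_subset_quadrant_or_outer:
  assumes "connected S" "S \<subseteq> quadrant \<sigma> \<tau> q \<union> outer \<sigma> \<tau> q"
  shows "S \<subseteq> quadrant \<sigma> \<tau> q \<or> S \<subseteq> outer \<sigma> \<tau> q"
  using connectedD[OF assms(1) open_quadrant[of \<sigma> \<tau> q] open_outer[of \<sigma> \<tau> q]]
    assms(2) quadrant_outer_disjoint[of \<sigma> \<tau> q] by blast

text \<open>
  A union of two overlapping open halfplanes.
\<close>

lemma connected_outer:
  assumes "\<sigma> \<noteq> 0" "\<tau> \<noteq> 0"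
  shows "connected (outer \<sigma> \<tau> q)"
proof -
  let ?A = "{p::point. \<sigma> * (fst p - fst q) < 0}" and ?B = "{p::point. \<tau> * (snd p - snd q) < 0}"
  have A: "?A = {p. (\<sigma>, 0) \<bullet> p < \<sigma> * fst q}" and B: "?B = {p. (0, \<tau>) \<bullet> p < \<tau> * snd q}"
    by (auto simp: inner_prod_def algebra_simps)
  have "(fst q - \<sigma>, snd q - \<tau>) \<in> ?A \<inter> ?B"
    using assms by (simp add: mult_pos_pos) (metis not_real_square_gt_zero)
  then have "?A \<inter> ?B \<noteq> {}"
    by blast
  moreover have "connected ?A" "connected ?B"
    unfolding A B by (simp_all add: convex_halfspace_lt convex_connected)
  ultimately have "connected (?A \<union> ?B)"
    by (intro connected_Un)
  moreover have "?A \<union> ?B = outer \<sigma> \<tau> q"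
    by (auto simp: outer_def)
  ultimately show ?thesis by simp
qed

lemma closure_outer:
  assumes "\<sigma> \<noteq> 0" "\<tau> \<noteq> 0"
  shows "closure (outer \<sigma> \<tau> q) = - quadrant \<sigma> \<tau> q"
proof -
  have "outer \<sigma> \<tau> q = {p. (\<sigma>, 0) \<bullet> p < \<sigma> * fst q} \<union> {p. (0, \<tau>) \<bullet> p < \<tau> * snd q}"
    by (auto simp: outer_def inner_prod_def algebra_simps)
  moreover have "(\<sigma>, 0::real) \<noteq> 0" "(0::real, \<tau>) \<noteq> 0"
    using assms by (auto simp: zero_prod_def)
  ultimately have "closure (outer \<sigma> \<tau> q)
      = {p. (\<sigma>, 0) \<bullet> p \<le> \<sigma> * fst q} \<union> {p. (0, \<tau>) \<bullet> p \<le> \<tau> * snd q}"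
    by (simp only: closure_Un closure_halfspace_lt not_False_eq_True)
  also have "\<dots> = - quadrant \<sigma> \<tau> q"
    by (auto simp: quadrant_def inner_prod_def right_diff_distrib not_less)
  finally show ?thesis .
qed

lemma closure_quadrant:
  assumes "\<sigma> \<noteq> 0" "\<tau> \<noteq> 0"
  shows "closure (quadrant \<sigma> \<tau> q) = - outer \<sigma> \<tau> q"
proof -
  have "quadrant \<sigma> \<tau> q = {x. \<sigma> \<bullet> x > \<sigma> * fst q} \<times> {y. \<tau> \<bullet> y > \<tau> * snd q}"
    by (auto simp: quadrant_def algebra_simps)
  then have "closure (quadrant \<sigma> \<tau> q)
      = {x. \<sigma> \<bullet> x \<ge> \<sigma> * fst q} \<times> {y. \<tau> \<bullet> y \<ge> \<tau> * snd q}"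
    using assms by (simp only: closure_Times closure_halfspace_gt not_False_eq_True simp_thms)
  then show ?thesis
    by (auto simp: outer_def algebra_simps not_less)
qed

text \<open>
  The two boundary rays are those spanned by a staircase segment with two edges and its bend at \<open>q\<close>.
\<close>

lemma staircase_line_quadrant_boundary:
  assumes "\<sigma> \<noteq> 0" "\<tau> \<noteq> 0"
  shows "staircase_line (- quadrant \<sigma> \<tau> q - outer \<sigma> \<tau> q)"
proof -
  define v :: "nat \<Rightarrow> point" where
    "v i = (if i = 0 then q + (\<sigma>, 0) else if i = 1 then q else q + (0, \<tau>))" for i
  have v: "v 0 = q + (\<sigma>, 0)" "v (Suc 0) = q" "v 2 = q + (0, \<tau>)" "v (Suc (Suc 0)) = q + (0, \<tau>)"
    by (simp_all add: v_def)
  have ne: "(\<sigma>, 0::real) \<noteq> 0" "(0::real, \<tau>) \<noteq> 0"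
    using assms by (auto simp: zero_prod_def)
  have two: "i < 2 \<longleftrightarrow> i = 0 \<or> i = Suc 0" for i :: nat
    by auto
  have one_two: "{1..2} = {1, 2::nat}"
    by auto
  have "closed_segment (q + (\<sigma>, 0)) q \<inter> closed_segment q (q + (0, \<tau>)) = {q}"
    using assms by (auto simp: closed_segment_def prod_eq_iff algebra_simps)
  then have simple: "simple_polyline v 2"
    unfolding simple_polyline_def using ne by (auto simp: two v)
  have segment: "staircase_segment v 2"
    unfolding staircase_segment_def one_two using simple ne
    by (auto simp: v same_direction_def axis_aligned_def intro: exI[of _ 1])
  have rays: "ray (v 1) (v 0) = (\<lambda>t. q + t *\<^sub>R (\<sigma>, 0)) ` {0..}"
      "ray (v (2 - 1)) (v 2) = (\<lambda>t. q + t *\<^sub>R (0, \<tau>)) ` {0..}"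
    by (simp_all add: ray_def v)
  have no_middle: "{1<..<2::nat} = {}"
    by auto
  have "- quadrant \<sigma> \<tau> q - outer \<sigma> \<tau> q = ray (v 1) (v 0) \<union>
      (\<Union>i\<in>{1<..<2}. closed_segment (v (i - 1)) (v i)) \<union> ray (v (2 - 1)) (v 2)" (is "?L = ?R")
  proof
    have "(x, y) \<in> ?R" if "(x, y) \<in> ?L" for x y
    proof -
      from that consider "x = fst q" "0 \<le> \<tau> * (y - snd q)" | "y = snd q" "0 \<le> \<sigma> * (x - fst q)"
        using assms by (auto simp: quadrant_def outer_def not_less less_le)
      then show ?thesis
      proof cases
        case 1
        then have "0 \<le> (y - snd q) / \<tau>"
          by (auto simp: zero_le_mult_iff zero_le_divide_iff)
        moreover have "(x, y) = q + ((y - snd q) / \<tau>) *\<^sub>R (0, \<tau>)"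
          using 1 assms by (simp add: prod_eq_iff)
        ultimately show ?thesis
          unfolding rays by blast
      next
        case 2
        then have "0 \<le> (x - fst q) / \<sigma>"
          by (auto simp: zero_le_mult_iff zero_le_divide_iff)
        moreover have "(x, y) = q + ((x - fst q) / \<sigma>) *\<^sub>R (\<sigma>, 0)"
          using 2 assms by (simp add: prod_eq_iff)
        ultimately show ?thesis
          unfolding rays by blast
      qed
    qed
    then show "?L \<subseteq> ?R" by auto
    have nonneg: "0 \<le> s * (t * s)" if "0 \<le> t" for s t :: real
      using mult_nonneg_nonneg[OF that, of "s * s"] by (simp add: mult.left_commute)
    show "?R \<subseteq> ?L"
      unfolding rays no_middle
      using nonneg by (auto simp: quadrant_def outer_def simp flip: not_le)
  qed
  with segment show ?thesis
    unfolding staircase_line_def by blast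
qed

lemma staircase_halfplane_quadrant_complement:
  assumes "\<sigma> \<noteq> 0" "\<tau> \<noteq> 0"
  shows "staircase_halfplane (- quadrant \<sigma> \<tau> q)"
proof -
  let ?Q = "quadrant \<sigma> \<tau> q" and ?W = "outer \<sigma> \<tau> q"
  have fr: "frontier (- ?Q) = - ?Q - ?W"
    using frontier_complement[of ?Q] closure_quadrant[OF assms, of q]
      interior_open[OF open_quadrant[of \<sigma> \<tau> q]] unfolding frontier_def[of ?Q] by blast
  have "(fst q - \<sigma>, snd q - \<tau>) \<in> ?W"
    using assms by (simp add: outer_def) (metis not_real_square_gt_zero)
  then have "?W \<in> components (?Q \<union> ?W)"
    unfolding in_components_maximal
    using connected_outer[OF assms] connected_subset_quadrant_or_outer quadrant_outer_disjoint
    by blast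
  moreover have "- frontier (- ?Q) = ?Q \<union> ?W"
    unfolding fr by auto
  ultimately have "- ?Q \<in> closure ` components (- frontier (- ?Q))"
    using closure_outer[OF assms, of q] by (metis imageI)
  then show ?thesis
    unfolding staircase_halfplane_def fr
    using staircase_line_quadrant_boundary[OF assms] open_quadrant by (simp add: closed_Compl)
qed

section \<open>Separating a point from an ortho-convex set by a quadrant\<close>

text \<open>
  The column through the centre \<open>(a, b)\<close> meets \<open>S\<close> only above or only below \<open>b\<close>, by ortho-convexity;
  say above. Suppose \<open>S\<close> has points of the strip on both sides, and let \<open>y2\<close> be the height of the
  higher one. The quadrant whose corner is \<open>(a, y2)\<close> and which opens downwards on the other side
  contains the lower point. Its boundary misses \<open>S\<close>: the vertical ray because \<open>S\<close> meets the column only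
  above the square, and the horizontal ray because with the higher point \<open>S\<close> would contain the corner.
  This splits the connected set \<open>S\<close>. Two points of equal height would put the point of the column at
  their height into \<open>S\<close>, by ortho-convexity, although that point is in the square.
\<close>

lemma one_sided_horizontal_strip:
  assumes conn: "connected S" and oc: "ortho_convex S" and e: "0 < e"
    and sq: "\<And>x y. \<bar>x - a\<bar> < e \<Longrightarrow> \<bar>y - b\<bar> < e \<Longrightarrow> (x, y) \<notin> S"
  shows "\<exists>\<sigma>\<in>{1, -1::real}. \<forall>x y. (x, y) \<in> S \<longrightarrow> \<bar>y - b\<bar> < e \<longrightarrow> 0 < \<sigma> * (x - a)"
proof -
  have "\<exists>\<tau>\<in>{1, -1::real}. \<forall>y. (a, y) \<in> S \<longrightarrow> 0 < \<tau> * (y - b)"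
  proof (rule ccontr)
    assume "\<not> ?thesis"
    then obtain y1 y2 where "(a, y1) \<in> S" "(a, y2) \<in> S" "y1 \<le> b" "b \<le> y2"
      by (auto simp: not_less)
    then have "(a, b) \<in> S"
      by (rule ortho_convex_verticalD[OF oc])
    then show False
      using sq e by simp
  qed
  then obtain \<tau> :: real where \<tau>: "\<tau> = 1 \<or> \<tau> = -1"
      and column: "\<And>y. (a, y) \<in> S \<Longrightarrow> 0 < \<tau> * (y - b)"
    by blast
  \<comment> \<open>The two points need not be taken from left to right: the sign \<open>\<kappa>\<close> says on which side
    the lower one is (lower with respect to the direction \<open>\<tau>\<close>).\<close>
  have contra: False
    if S: "(x1, y1) \<in> S" "(x2, y2) \<in> S" and x: "0 < \<kappa> * (x1 - a)" "\<kappa> * (x2 - a) < 0"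
      and y: "\<bar>y2 - b\<bar> < e" "\<tau> * y1 < \<tau> * y2" for \<kappa> x1 y1 x2 y2
  proof -
    let ?q = "(a, y2)"
    have "(x, y) \<in> quadrant \<kappa> (-\<tau>) ?q \<union> outer \<kappa> (-\<tau>) ?q" if xy: "(x, y) \<in> S" for x y
    proof (rule ccontr)
      assume not: "\<not> ?thesis"
      then have le: "0 \<le> \<kappa> * (x - a)" "\<tau> * (y - y2) \<le> 0"
        and "\<kappa> * (x - a) = 0 \<or> \<tau> * (y - y2) = 0"
        by (auto simp: quadrant_def outer_def not_less)
      then consider "x = a" | "y = y2"
        using \<tau> x by auto
      then show False
      proof cases
        case 1
        with column xy have "0 < \<tau> * (y - b)" by blast
        with le(2) y(1) \<tau> have "\<bar>y - b\<bar> < e" by auto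
        with sq 1 xy e show False by simp
      next
        case 2
        have "(a, y2) \<in> S"
        proof (cases "x \<le> a")
          case True
          with le(1) x have "a \<le> x2 \<or> x = a"
            by (auto simp: zero_le_mult_iff mult_less_0_iff zero_less_mult_iff)
          with True xy S(2) 2 show ?thesis
            using ortho_convex_horizontalD[OF oc, of x y2 x2 a] by auto
        next
          case False
          with le(1) x have "x2 \<le> a"
            by (auto simp: zero_le_mult_iff mult_less_0_iff zero_less_mult_iff)
          with False xy S(2) 2 show ?thesis
            using ortho_convex_horizontalD[OF oc, of x2 y2 x a] by auto
        qed
        with sq y(1) e show False by simp
      qed
    qed
    then have "S \<subseteq> quadrant \<kappa> (-\<tau>) ?q \<union> outer \<kappa> (-\<tau>) ?q"
      by auto
    from connected_subset_quadrant_or_outer[OF conn this] S x y show False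
      by (auto simp: quadrant_def outer_def algebra_simps)
  qed
  show ?thesis
  proof (rule ccontr)
    assume "\<not> ?thesis"
    then obtain x1 y1 x2 y2 where
      1: "(x1, y1) \<in> S" "\<bar>y1 - b\<bar> < e" "a \<le> x1" and 2: "(x2, y2) \<in> S" "\<bar>y2 - b\<bar> < e" "x2 \<le> a"
      by (auto simp: not_less)
    then have x: "a < x1" "x2 < a"
      using sq[of a] e by (auto simp: less_le)
    consider "\<tau> * y1 < \<tau> * y2" | "\<tau> * y2 < \<tau> * y1" | "y1 = y2"
      using \<tau> by force
    then show False
    proof cases
      case 1
      then show False
        using contra[of x1 y1 x2 y2 1] \<open>(x1, y1) \<in> S\<close> 2 x by simp
    next
      case 2
      then show False
        using contra[of x2 y2 x1 y1 "-1"] \<open>(x2, y2) \<in> S\<close> 1 x by simp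
    next
      case 3
      then show False
        using ortho_convex_horizontalD[OF oc, of x2 y1 x1 a] 1 2 x sq[of a y1] e by simp
    qed
  qed
qed

text \<open>
  The offset \<open>d\<close> is so small that the corner of the quadrant stays inside the empty square, so
  the boundary rays of the quadrant stay in the two strips, on the side where \<open>S\<close> is absent.
\<close>

lemma separating_quadrant:
  assumes conn: "connected S" and oc: "ortho_convex S" and "closed S" "p \<notin> S"
  obtains \<sigma> \<tau> q where "\<sigma> \<noteq> 0" "\<tau> \<noteq> 0" "p \<in> quadrant \<sigma> \<tau> q" "S \<inter> quadrant \<sigma> \<tau> q = {}"
proof -
  obtain a b where p: "p = (a, b)" by fastforce
  obtain r where r: "0 < r" "ball p r \<subseteq> - S"
    using assms(3,4) by (metis ComplI open_Compl openE)
  define e where "e = r / 2"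
  have e: "0 < e" using r by (simp add: e_def)
  have sq: "(x, y) \<notin> S" if "\<bar>x - a\<bar> < e" "\<bar>y - b\<bar> < e" for x y
  proof -
    have "norm ((a, b) - (x, y)) \<le> norm (a - x) + norm (b - y)"
      by (simp add: norm_Pair sqrt_sum_squares_le_sum_abs)
    then have "dist p (x, y) < r"
      using that abs_minus_commute[of a x] abs_minus_commute[of b y] by (simp add: p dist_norm e_def)
    with r show ?thesis by auto
  qed
  obtain \<sigma> :: real where \<sigma>: "\<sigma> = 1 \<or> \<sigma> = -1"
      and hor: "\<And>x y. (x, y) \<in> S \<Longrightarrow> \<bar>y - b\<bar> < e \<Longrightarrow> 0 < \<sigma> * (x - a)"
    using one_sided_horizontal_strip[OF conn oc e sq] by blast
  have "connected (prod.swap ` S)"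
    by (intro connected_continuous_image conn continuous_on_swap)
  then have "\<exists>\<tau>\<in>{1, -1::real}. \<forall>y x. (y, x) \<in> prod.swap ` S \<longrightarrow> \<bar>x - a\<bar> < e \<longrightarrow> 0 < \<tau> * (y - b)"
    by (rule one_sided_horizontal_strip[OF _ ortho_convex_swap[OF oc] e]) (use sq in simp)
  then obtain \<tau> :: real where \<tau>: "\<tau> = 1 \<or> \<tau> = -1"
      and ver: "\<And>x y. (x, y) \<in> S \<Longrightarrow> \<bar>x - a\<bar> < e \<Longrightarrow> 0 < \<tau> * (y - b)"
    unfolding pair_in_swap_image by blast
  define d where "d = e / 2"
  have d: "0 < d" "d < e" using e by (auto simp: d_def)
  let ?q = "(a + \<sigma> * d, b + \<tau> * d)"
  have "(x, y) \<in> quadrant (-\<sigma>) (-\<tau>) ?q \<union> outer (-\<sigma>) (-\<tau>) ?q" if "(x, y) \<in> S" for x y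
    using that hor[of x y] ver[of x y] sq[of x y] \<sigma> \<tau> d
    by (elim disjE; simp add: quadrant_def outer_def; smt (verit))
  then have "S \<subseteq> quadrant (-\<sigma>) (-\<tau>) ?q \<union> outer (-\<sigma>) (-\<tau>) ?q"
    by auto
  from connected_subset_quadrant_or_outer[OF conn this]
  show ?thesis
  proof
    assume "S \<subseteq> outer (-\<sigma>) (-\<tau>) ?q"
    then have "S \<inter> quadrant (-\<sigma>) (-\<tau>) ?q = {}"
      using quadrant_outer_disjoint by blast
    moreover have "p \<in> quadrant (-\<sigma>) (-\<tau>) ?q"
      using \<sigma> \<tau> d by (auto simp: p quadrant_def)
    ultimately show ?thesis
      using that[of "-\<sigma>" "-\<tau>" ?q] \<sigma> \<tau> by auto
  next
    let ?q' = "(a - \<sigma> * d, b - \<tau> * d)"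
    \<comment> \<open>A point of \<open>S\<close> in both opposite overlapping quadrants would be in the empty square.\<close>
    assume inner: "S \<subseteq> quadrant (-\<sigma>) (-\<tau>) ?q"
    have "(x, y) \<notin> quadrant \<sigma> \<tau> ?q'" if "(x, y) \<in> S" for x y
    proof -
      have "(x, y) \<in> quadrant (-\<sigma>) (-\<tau>) ?q"
        using that inner by blast
      then show ?thesis
        using that sq[of x y] \<sigma> \<tau> d by (auto simp: quadrant_def abs_less_iff)
    qed
    then have "S \<inter> quadrant \<sigma> \<tau> ?q' = {}"
      by auto
    moreover have "p \<in> quadrant \<sigma> \<tau> ?q'"
      using \<sigma> \<tau> d by (auto simp: p quadrant_def)
    ultimately show ?thesis
      using that[of \<sigma> \<tau> ?q'] \<sigma> \<tau> by auto
  qed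
qed

section \<open>Sets closed under the steps of an orthant\<close>

text \<open>
  The closed quadrant at the origin, used as a cone of directions: \<open>q - p \<in> orthant \<sigma> \<tau>\<close> is the
  product order on the plane, with the order on each axis reversed where the sign is negative.
\<close>

definition orthant :: "real \<Rightarrow> real \<Rightarrow> point set" where
  "orthant \<sigma> \<tau> = {d. 0 \<le> \<sigma> * fst d \<and> 0 \<le> \<tau> * snd d}"

lemma orthant_add: "c \<in> orthant \<sigma> \<tau> \<Longrightarrow> d \<in> orthant \<sigma> \<tau> \<Longrightarrow> c + d \<in> orthant \<sigma> \<tau>"
  by (simp add: orthant_def distrib_left)

lemma orthant_scale: "d \<in> orthant \<sigma> \<tau> \<Longrightarrow> 0 \<le> c \<Longrightarrow> c *\<^sub>R d \<in> orthant \<sigma> \<tau>"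
  by (simp add: orthant_def mult.left_commute[of \<sigma> c] mult.left_commute[of \<tau> c])

text \<open>
  On a horizontal or vertical line all steps of the orthant go in one direction, so each of two points
  of \<open>H\<close> carries a half-line of \<open>H\<close> in that direction, and one of these covers the gap between them.
\<close>

lemma ortho_convex_if_absorbs_orthant:
  assumes "\<alpha> \<noteq> 0" "\<beta> \<noteq> 0"
    and absorb: "\<And>z d. z \<in> H \<Longrightarrow> d \<in> orthant \<alpha> \<beta> \<Longrightarrow> z + d \<in> H"
  shows "ortho_convex H"
  unfolding ortho_convex_iff_intervals is_interval_1
proof (intro conjI allI ballI impI; clarify)
  fix y a b x
  assume H: "(a, y) \<in> H" "(b, y) \<in> H" "a \<le> x" "x \<le> b"
  show "(x, y) \<in> H"
    using absorb[OF H(1), of "(x - a, 0)"] absorb[OF H(2), of "(x - b, 0)"] H(3,4)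
    by (cases "0 \<le> \<alpha>") (simp_all add: orthant_def mult_nonpos_nonpos)
next
  fix x a b y
  assume H: "(x, a) \<in> H" "(x, b) \<in> H" "a \<le> y" "y \<le> b"
  show "(x, y) \<in> H"
    using absorb[OF H(1), of "(0, y - a)"] absorb[OF H(2), of "(0, y - b)"] H(3,4)
    by (cases "0 \<le> \<beta>") (simp_all add: orthant_def mult_nonpos_nonpos)
qed

section \<open>Staircase lines are monotone\<close>

definition monotone_chain :: "real \<Rightarrow> real \<Rightarrow> point set \<Rightarrow> bool" where
  "monotone_chain \<sigma> \<tau> X \<longleftrightarrow> (\<forall>p\<in>X. \<forall>q\<in>X. q - p \<in> orthant \<sigma> \<tau> \<or> p - q \<in> orthant \<sigma> \<tau>)"

lemma monotone_chain_append:
  assumes "monotone_chain \<sigma> \<tau> X" "monotone_chain \<sigma> \<tau> Y"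
    and "\<And>p. p \<in> X \<Longrightarrow> m - p \<in> orthant \<sigma> \<tau>" "\<And>p. p \<in> Y \<Longrightarrow> p - m \<in> orthant \<sigma> \<tau>"
  shows "monotone_chain \<sigma> \<tau> (X \<union> Y)"
proof -
  have "q - p \<in> orthant \<sigma> \<tau>" if "p \<in> X" "q \<in> Y" for p q
    using orthant_add[OF assms(4)[OF that(2)] assms(3)[OF that(1)]] by simp
  then show ?thesis
    using assms(1,2) unfolding monotone_chain_def by blast
qed

lemma monotone_chain_line_image:
  assumes "d \<in> orthant \<sigma> \<tau>"
  shows "monotone_chain \<sigma> \<tau> ((\<lambda>t. a + t *\<^sub>R d) ` T)"
proof -
  have "(a + t *\<^sub>R d) - (a + s *\<^sub>R d) \<in> orthant \<sigma> \<tau>" if "s \<le> t" for s t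
    using orthant_scale[OF assms, of "t - s"] that by (simp add: scaleR_diff_left)
  then show ?thesis
    unfolding monotone_chain_def by (auto simp del: add_diff_cancel_left) (meson linear)+
qed

lemma connected_line_image:
  fixes a d :: point
  assumes "connected T"
  shows "connected ((\<lambda>t. a + t *\<^sub>R d) ` T)"
  by (intro connected_continuous_image assms continuous_intros)

lemma closed_segment_eq_line_image:
  "closed_segment a b = (\<lambda>t. a + t *\<^sub>R (b - a)) ` {0..1}" for a b :: point
  by (auto simp: closed_segment_image_interval algebra_simps)

lemma ray_eq_line_image_reversed: "ray a b = (\<lambda>t. a + t *\<^sub>R (a - b)) ` {..0}"
proof -
  have "a + t *\<^sub>R (b - a) = a + (- t) *\<^sub>R (a - b)" for t
    by (simp add: algebra_simps)
  moreover have "uminus ` {0..} = {..0::real}"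
    by simp
  ultimately show ?thesis
    unfolding ray_def by (metis (no_types, lifting) image_cong image_image)
qed

text \<open>
  If matching coordinates had opposite signs, the other coordinates would vanish, and the vectors would
  point in opposite directions on one axis.
\<close>

lemma common_orthant:
  assumes "fst u = 0 \<or> snd u = 0" "fst w = 0 \<or> snd w = 0"
    and not_opposite: "\<And>c. 0 < c \<Longrightarrow> w \<noteq> - c *\<^sub>R u"
  obtains \<sigma> \<tau> where "\<sigma> = 1 \<or> \<sigma> = -1" "\<tau> = 1 \<or> \<tau> = -1" "u \<in> orthant \<sigma> \<tau>" "w \<in> orthant \<sigma> \<tau>"
proof -
  have "0 \<le> fst u * fst w"
  proof (rule ccontr)
    assume "\<not> ?thesis"
    then have "fst u * fst w < 0" "snd u = 0" "snd w = 0"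
      using assms(1,2) by auto
    then show False
      using not_opposite[of "- (fst w / fst u)"]
      by (auto simp: prod_eq_iff mult_less_0_iff divide_less_0_iff)
  qed
  then obtain \<sigma> :: real where \<sigma>: "\<sigma> = 1 \<or> \<sigma> = -1" "0 \<le> \<sigma> * fst u" "0 \<le> \<sigma> * fst w"
    by (force simp: zero_le_mult_iff)
  have "0 \<le> snd u * snd w"
  proof (rule ccontr)
    assume "\<not> ?thesis"
    then have "snd u * snd w < 0" "fst u = 0" "fst w = 0"
      using assms(1,2) by auto
    then show False
      using not_opposite[of "- (snd w / snd u)"]
      by (auto simp: prod_eq_iff mult_less_0_iff divide_less_0_iff)
  qed
  then obtain \<tau> :: real where \<tau>: "\<tau> = 1 \<or> \<tau> = -1" "0 \<le> \<tau> * snd u" "0 \<le> \<tau> * snd w"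
    by (force simp: zero_le_mult_iff)
  show thesis
    using that[of \<sigma> \<tau>] \<sigma> \<tau> by (simp add: orthant_def)
qed

text \<open>
  If the second edge turned back, the endpoint of the shorter of the two edges would be a second
  common point.
\<close>

lemma simple_polyline_no_reversal:
  assumes "simple_polyline v n" "2 \<le> n" "0 < c"
  shows "v 2 - v 1 \<noteq> - c *\<^sub>R (v 1 - v 0)"
proof
  assume eq: "v 2 - v 1 = - c *\<^sub>R (v 1 - v 0)"
  have ne: "v 0 \<noteq> v 1"
    using assms(1,2) unfolding simple_polyline_def by (metis One_nat_def less_le_trans zero_less_numeral)
  have "closed_segment (v 0) (v (Suc 0)) \<inter> closed_segment (v 1) (v (Suc 1))
      = (if 1 = Suc 0 then {v 1} else {})"
    using assms(1,2) unfolding simple_polyline_def by (meson less_le_trans one_less_numeral_iff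
      semiring_norm(76) zero_less_one)
  then have meet: "closed_segment (v 0) (v 1) \<inter> closed_segment (v 1) (v 2) = {v 1}"
    by (simp add: numeral_2_eq_2)
  show False
  proof (cases "c \<le> 1")
    case True
    have v2: "v 2 = v 0 + (1 - c) *\<^sub>R (v 1 - v 0)"
      using eq by (simp add: algebra_simps)
    then have "v 2 \<in> closed_segment (v 0) (v 1)"
      unfolding closed_segment_eq_line_image using True \<open>0 < c\<close> by auto
    then have "v 2 = v 1"
      using meet by auto
    with eq ne \<open>0 < c\<close> show False by simp
  next
    case False
    have "v 0 = v 1 + (1 / c) *\<^sub>R (v 2 - v 1)"
      using eq \<open>0 < c\<close> by simp
    then have "v 0 \<in> closed_segment (v 1) (v 2)"
      unfolding closed_segment_eq_line_image using False \<open>0 < c\<close> by (intro image_eqI[of _ _ "1 / c"]) auto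
    with meet ne show False by auto
  qed
qed

lemma staircase_segment_steps_in_orthant:
  assumes "staircase_segment v n"
  obtains \<sigma> \<tau> where "\<sigma> = 1 \<or> \<sigma> = -1" "\<tau> = 1 \<or> \<tau> = -1"
    "\<And>i. i < n \<Longrightarrow> v (Suc i) - v i \<in> orthant \<sigma> \<tau>"
proof -
  define u where "u = v 1 - v 0"
  \<comment> \<open>For a single edge, \<open>u\<close> itself serves as the direction of the even edges.\<close>
  define w where "w = (if 2 \<le> n then v 2 - v 1 else u)"
  have n: "1 \<le> n" and simple: "simple_polyline v n"
    and axis: "\<And>i. i \<in> {1..n} \<Longrightarrow> axis_aligned (v (i - 1)) (v i)"
    and odd: "\<And>i j. i \<in> {1..n} \<Longrightarrow> j \<in> {1..n} \<Longrightarrow> odd i \<Longrightarrow> odd j \<Longrightarrow>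
      same_direction (v i - v (i - 1)) (v j - v (j - 1))"
    and even: "\<And>i j. i \<in> {1..n} \<Longrightarrow> j \<in> {1..n} \<Longrightarrow> even i \<Longrightarrow> even j \<Longrightarrow>
      same_direction (v i - v (i - 1)) (v j - v (j - 1))"
    using assms unfolding staircase_segment_def by blast+
  have u: "fst u = 0 \<or> snd u = 0"
    using axis[of 1] n by (auto simp: u_def axis_aligned_def)
  have w: "fst w = 0 \<or> snd w = 0"
    using axis[of 2] u by (auto simp: w_def axis_aligned_def)
  have "u \<noteq> 0"
    using simple n by (auto simp: u_def simple_polyline_def)
  have "w \<noteq> - c *\<^sub>R u" if "0 < c" for c
  proof (cases "2 \<le> n")
    case True
    then show ?thesis
      using simple_polyline_no_reversal[OF simple True that] by (simp add: w_def u_def)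
  next
    case False
    have "(1 + c) *\<^sub>R u \<noteq> 0"
      using \<open>u \<noteq> 0\<close> that by simp
    with False show ?thesis
      by (auto simp: w_def scaleR_add_left eq_neg_iff_add_eq_0)
  qed
  then obtain \<sigma> \<tau> where st: "\<sigma> = 1 \<or> \<sigma> = -1" "\<tau> = 1 \<or> \<tau> = -1"
      and "u \<in> orthant \<sigma> \<tau>" "w \<in> orthant \<sigma> \<tau>"
    using common_orthant[OF u w] by blast
  have "v (Suc i) - v i \<in> orthant \<sigma> \<tau>" if i: "i < n" for i
  proof (cases "even i")
    case True
    then have "same_direction u (v (Suc i) - v i)"
      using odd[of 1 "Suc i"] i n by (simp add: u_def)
    with \<open>u \<in> orthant \<sigma> \<tau>\<close> show ?thesis
      by (auto simp: same_direction_def intro!: orthant_scale)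
  next
    case False
    then have "2 \<le> n"
      using i by (cases i) auto
    with False have "same_direction w (v (Suc i) - v i)"
      using even[of 2 "Suc i"] i by (simp add: w_def)
    with \<open>w \<in> orthant \<sigma> \<tau>\<close> show ?thesis
      by (auto simp: same_direction_def intro!: orthant_scale)
  qed
  with that st show thesis by blast
qed

lemma orthant_sum_pos:
  assumes "\<sigma> \<noteq> 0" "\<tau> \<noteq> 0" "d \<in> orthant \<sigma> \<tau>" "d \<noteq> 0"
  shows "0 < \<sigma> * fst d + \<tau> * snd d"
proof -
  have "\<sigma> * fst d \<noteq> 0 \<or> \<tau> * snd d \<noteq> 0"
    using assms by (simp add: prod_eq_iff)
  then show ?thesis
    using assms(3) unfolding orthant_def mem_Collect_eq by linarith
qed

text \<open>
  The monotone chain is assembled edge by edge: the first ray and the bounded edges are joined at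
  the vertices, each of which is the greatest point so far and the least point of the next piece.
  The initial parts \<open>L k\<close> end at the vertex \<open>v k\<close>. The last ray then makes the line unbounded in both directions,
  so the intermediate value theorem applied to \<open>\<sigma> * fst p + \<tau> * snd p\<close> yields the last claim.
\<close>

lemma staircase_line_structure:
  assumes "staircase_line l"
  obtains \<sigma> \<tau> where "\<sigma> = 1 \<or> \<sigma> = -1" "\<tau> = 1 \<or> \<tau> = -1" "monotone_chain \<sigma> \<tau> l"
    "\<And>s. \<exists>p\<in>l. \<sigma> * fst p + \<tau> * snd p = s"
proof -
  obtain v n where seg: "staircase_segment v n"
    and l: "l = ray (v 1) (v 0) \<union> (\<Union>i\<in>{1<..<n}. closed_segment (v (i - 1)) (v i))
              \<union> ray (v (n - 1)) (v n)"
    using assms unfolding staircase_line_def by blast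
  obtain \<sigma> \<tau> where st: "\<sigma> = 1 \<or> \<sigma> = -1" "\<tau> = 1 \<or> \<tau> = -1"
      and step: "\<And>i. i < n \<Longrightarrow> v (Suc i) - v i \<in> orthant \<sigma> \<tau>"
    using staircase_segment_steps_in_orthant[OF seg] by blast
  have n: "1 \<le> n" and ne: "\<And>i. i < n \<Longrightarrow> v i \<noteq> v (Suc i)"
    using seg unfolding staircase_segment_def simple_polyline_def by blast+
  define L where "L k = ray (v 1) (v 0) \<union> (\<Union>i\<in>{1<..k}. closed_segment (v (i - 1)) (v i))" for k
  have initial: "monotone_chain \<sigma> \<tau> (L k) \<and> connected (L k) \<and> v k \<in> L k \<and> (\<forall>p\<in>L k. v k - p \<in> orthant \<sigma> \<tau>)"
    if "1 \<le> k" "k \<le> n" for k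
    using that
  proof (induction k rule: dec_induct)
    case base
    have d: "v 1 - v 0 \<in> orthant \<sigma> \<tau>"
      using step[of 0] n by simp
    have "L 1 = (\<lambda>t. v 1 + t *\<^sub>R (v 1 - v 0)) ` {..0}"
      by (simp add: L_def ray_eq_line_image_reversed)
    moreover have "v 1 - (v 1 + t *\<^sub>R (v 1 - v 0)) \<in> orthant \<sigma> \<tau>" if "t \<le> 0" for t
      using orthant_scale[OF d, of "- t"] that by simp
    moreover have "v 1 \<in> (\<lambda>t. v 1 + t *\<^sub>R (v 1 - v 0)) ` {..0}"
      by (intro image_eqI[of _ _ 0]) auto
    ultimately show ?case
      using monotone_chain_line_image[OF d, of "v 1" "{..0}"]
        connected_line_image[of "{..0}" "v 1" "v 1 - v 0"] by auto
  next
    case (step k)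
    let ?Y = "closed_segment (v k) (v (Suc k))"
    have d: "v (Suc k) - v k \<in> orthant \<sigma> \<tau>"
      using \<open>\<And>i. i < n \<Longrightarrow> v (Suc i) - v i \<in> orthant \<sigma> \<tau>\<close> step.prems by simp
    have IH: "monotone_chain \<sigma> \<tau> (L k)" "connected (L k)" "v k \<in> L k" "\<And>p. p \<in> L k \<Longrightarrow> v k - p \<in> orthant \<sigma> \<tau>"
      using step.IH step.prems by auto
    have "{1<..Suc k} = insert (Suc k) {1<..k}"
      using step.hyps by auto
    then have L: "L (Suc k) = L k \<union> ?Y"
      by (auto simp: L_def)
    have low: "p - v k \<in> orthant \<sigma> \<tau>" and high: "v (Suc k) - p \<in> orthant \<sigma> \<tau>" if p: "p \<in> ?Y" for p
    proof -
      obtain t where t: "0 \<le> t" "t \<le> 1" "p = v k + t *\<^sub>R (v (Suc k) - v k)"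
        using p unfolding closed_segment_eq_line_image by auto
      show "p - v k \<in> orthant \<sigma> \<tau>"
        using orthant_scale[OF d t(1)] t(3) by simp
      have "v (Suc k) - p = (1 - t) *\<^sub>R (v (Suc k) - v k)"
        by (simp add: t(3) algebra_simps)
      then show "v (Suc k) - p \<in> orthant \<sigma> \<tau>"
        using orthant_scale[OF d, of "1 - t"] t(2) by simp
    qed
    have "monotone_chain \<sigma> \<tau> ?Y"
      unfolding closed_segment_eq_line_image by (rule monotone_chain_line_image[OF d])
    then have "monotone_chain \<sigma> \<tau> (L k \<union> ?Y)"
      using monotone_chain_append IH(1,4) low by blast
    moreover have "connected (L k \<union> ?Y)"
      using IH(2,3) by (intro connected_Un) auto
    moreover have "v (Suc k) - p \<in> orthant \<sigma> \<tau>" if "p \<in> L k" for p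
      using orthant_add[OF d IH(4)[OF that]] by simp
    ultimately show ?case
      unfolding L using high by auto
  qed
  \<comment> \<open>For \<open>n = 1\<close> the two rays overlap in the edge; the second one is cut off at \<open>v 1\<close> so that
    here too an initial part is continued by a ray from its end.\<close>
  obtain m e where m: "1 \<le> m" "m \<le> n" and e: "e \<in> orthant \<sigma> \<tau>" "e \<noteq> 0"
      and lL: "l = L m \<union> (\<lambda>t. v m + t *\<^sub>R e) ` {0..}"
  proof (cases "n = 1")
    case True
    let ?d = "v 1 - v 0"
    have "l = L 1 \<union> ray (v 0) (v 1)"
      unfolding l L_def True by simp
    also have "\<dots> = L 1 \<union> (\<lambda>t. v 1 + t *\<^sub>R ?d) ` {0..}"
    proof -
      have L1: "L 1 = (\<lambda>t. v 1 + t *\<^sub>R ?d) ` {..0}"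
        by (simp add: L_def ray_eq_line_image_reversed)
      have shift: "v 0 + t *\<^sub>R ?d = v 1 + (t - 1) *\<^sub>R ?d" for t
        by (simp add: algebra_simps)
      have "ray (v 0) (v 1) = (\<lambda>t. v 1 + t *\<^sub>R ?d) ` ((\<lambda>t. t - 1) ` {0..})"
        unfolding ray_def shift image_image ..
      also have "(\<lambda>t. t - 1) ` {0..} = {-1::real..}"
        by (auto intro!: image_eqI[of _ _ "_ + 1"])
      finally have ray: "ray (v 0) (v 1) = (\<lambda>t. v 1 + t *\<^sub>R ?d) ` {-1..}" .
      have "{..0} \<union> {-1..} = {..0} \<union> {0::real..}"
        by auto
      then show ?thesis
        unfolding L1 ray by (metis image_Un)
    qed
    finally show ?thesis
      using that[of 1 ?d] step[of 0] ne[of 0] True by auto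
  next
    case False
    then have "{1<..<n} = {1<..n - 1}" "Suc (n - 1) = n" "1 \<le> n - 1"
      using n by auto
    then show ?thesis
      using that[of "n - 1" "v n - v (n - 1)"] step[of "n - 1"] ne[of "n - 1"] n
      unfolding l L_def ray_def by auto
  qed
  let ?R = "(\<lambda>t. v m + t *\<^sub>R e) ` {0..}"
  have Lm: "monotone_chain \<sigma> \<tau> (L m)" "connected (L m)" "v m \<in> L m" "\<And>p. p \<in> L m \<Longrightarrow> v m - p \<in> orthant \<sigma> \<tau>"
    using initial[OF m] by auto
  have "p - v m \<in> orthant \<sigma> \<tau>" if "p \<in> ?R" for p
    using that orthant_scale[OF e(1)] by auto
  then have chain: "monotone_chain \<sigma> \<tau> l"
    unfolding lL using monotone_chain_append[OF Lm(1) monotone_chain_line_image[OF e(1)] Lm(4)] by blast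
  have "v m \<in> ?R"
    by (intro image_eqI[of _ _ 0]) auto
  then have conn: "connected l"
    unfolding lL using Lm(2,3) connected_line_image[of "{0..}"] by (intro connected_Un) auto
  have onto: "\<exists>p\<in>l. \<sigma> * fst p + \<tau> * snd p = s" for s
  proof -
    let ?\<phi> = "\<lambda>p. \<sigma> * fst p + \<tau> * snd p :: real"
    have nz: "\<sigma> \<noteq> 0" "\<tau> \<noteq> 0" using st by auto
    have unbounded: "\<exists>t\<ge>0. b \<le> a + t * c" if "0 < c" for a b c :: real
      using that by (intro exI[of _ "max 0 ((b - a) / c)"]) (simp add: field_simps max_def)
    have \<phi>: "?\<phi> (p + t *\<^sub>R d) = ?\<phi> p + t * ?\<phi> d" for p t d
      by (simp add: algebra_simps)
    have "0 < ?\<phi> e"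
      using orthant_sum_pos[OF nz e] .
    then obtain t where "0 \<le> t" "s \<le> ?\<phi> (v m + t *\<^sub>R e)"
      unfolding \<phi> using unbounded by blast
    then obtain q where q: "q \<in> l" "s \<le> ?\<phi> q"
      unfolding lL by blast
    have "0 < ?\<phi> (v 1 - v 0)"
      using orthant_sum_pos[OF nz, of "v 1 - v 0"] step[of 0] ne[of 0] n by auto
    then obtain t where "0 \<le> t" "- s \<le> - ?\<phi> (v 1) + t * ?\<phi> (v 1 - v 0)"
      using unbounded by blast
    then have "- t \<in> {..0}" "?\<phi> (v 1 + (- t) *\<^sub>R (v 1 - v 0)) \<le> s"
      unfolding \<phi> by simp_all
    then obtain p where p: "p \<in> l" "?\<phi> p \<le> s"
      unfolding l ray_eq_line_image_reversed[of "v 1"] by blast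
    have "connected (?\<phi> ` l)"
      by (intro connected_continuous_image conn continuous_intros)
    then have "s \<in> ?\<phi> ` l"
      using p q by (meson connected_contains_Icc image_eqI atLeastAtMost_iff subsetD)
    then show ?thesis by blast
  qed
  show thesis
    using that st chain onto by blast
qed

section \<open>Ortho-convexity of staircase-halfplanes\<close>

text \<open>
  In the coordinates \<open>\<phi>\<close> and \<open>\<psi>\<close> the order cone of the chain is \<open>\<bar>\<psi>\<bar> \<le> \<phi>\<close>, so \<open>l\<close> is the graph of a
  function \<open>g\<close> with Lipschitz constant 1. The two sides of the graph are open, hence the connected set
  \<open>C\<close> lies in one of them. On the upper side, a step in \<open>orthant \<sigma> (- \<tau>)\<close> raises \<open>\<psi>\<close> by at least
  the change of \<open>\<phi>\<close>, hence by at least the change of \<open>g\<close>, and stays on that side; on the lower side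
  the opposite steps do.
  As \<open>C\<close> is a component, it contains the segments along which these steps are made.
\<close>

lemma ortho_convex_closure_component:
  assumes st: "\<sigma> = 1 \<or> \<sigma> = -1" "\<tau> = 1 \<or> \<tau> = -1" and chain: "monotone_chain \<sigma> \<tau> l"
    and onto: "\<And>s. \<exists>p\<in>l. \<sigma> * fst p + \<tau> * snd p = s"
    and C: "C \<in> components (- l)"
  shows "ortho_convex (closure C)"
proof -
  define \<phi> :: "point \<Rightarrow> real" where "\<phi> p = \<sigma> * fst p + \<tau> * snd p" for p
  define \<psi> :: "point \<Rightarrow> real" where "\<psi> p = \<sigma> * fst p - \<tau> * snd p" for p
  have add: "\<phi> (p + q) = \<phi> p + \<phi> q" "\<psi> (p + q) = \<psi> p + \<psi> q" for p q
    by (simp_all add: \<phi>_def \<psi>_def algebra_simps)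
  have steep: "\<bar>\<psi> p - \<psi> q\<bar> \<le> \<bar>\<phi> p - \<phi> q\<bar>" if "p \<in> l" "q \<in> l" for p q
    using chain that unfolding monotone_chain_def orthant_def \<phi>_def \<psi>_def
    by (force simp: right_diff_distrib abs_if)
  obtain \<gamma> where \<gamma>: "\<And>s. \<gamma> s \<in> l" "\<And>s. \<phi> (\<gamma> s) = s"
    using onto unfolding \<phi>_def by metis
  define g where "g s = \<psi> (\<gamma> s)" for s
  have graph: "\<psi> p = g (\<phi> p)" if "p \<in> l" for p
    using steep[OF that \<gamma>(1), of "\<phi> p"] by (simp add: \<gamma> g_def)
  have lip: "\<bar>g s - g t\<bar> \<le> \<bar>s - t\<bar>" for s t
    using steep[OF \<gamma>(1) \<gamma>(1), of s t] by (simp add: \<gamma> g_def)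
  have "continuous_on UNIV g"
    by (rule lipschitz_on_continuous_on[of 1]) (simp add: lipschitz_on_def dist_real_def lip)
  then have cont: "continuous_on UNIV (\<lambda>z. g (\<phi> z))"
    by (rule continuous_on_compose2) (auto simp: \<phi>_def intro!: continuous_intros)
  define side where "side \<kappa> = {z. 0 < \<kappa> * (\<psi> z - g (\<phi> z))}" for \<kappa> :: real
  have open_side: "open (side \<kappa>)" for \<kappa>
    unfolding side_def \<psi>_def by (intro open_Collect_less continuous_intros cont)
  have side_avoids: "side \<kappa> \<subseteq> - l" for \<kappa>
    using graph by (auto simp: side_def)
  have side_step: "z + d \<in> side \<kappa>"
    if \<kappa>: "\<kappa> = 1 \<or> \<kappa> = -1" and z: "z \<in> side \<kappa>" and d: "d \<in> orthant (\<kappa> * \<sigma>) (- \<kappa> * \<tau>)" for z d \<kappa>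
  proof -
    have "\<bar>\<phi> d\<bar> \<le> \<kappa> * \<psi> d"
      using d \<kappa> by (auto simp: orthant_def \<phi>_def \<psi>_def)
    then show ?thesis
      using lip[of "\<phi> z + \<phi> d" "\<phi> z"] z \<kappa> by (auto simp: side_def add)
  qed
  have conn: "connected C" and sub: "C \<subseteq> - l"
    using C in_components_connected in_components_subset by blast+
  have "z \<in> l" if "\<psi> z = g (\<phi> z)" for z
  proof -
    have "\<psi> (\<gamma> (\<phi> z)) = \<psi> z" "\<phi> (\<gamma> (\<phi> z)) = \<phi> z"
      using that \<gamma> by (simp_all add: g_def)
    then have "\<gamma> (\<phi> z) = z"
      using st by (auto simp: \<phi>_def \<psi>_def prod_eq_iff)
    then show ?thesis using \<gamma>(1) by metis
  qed
  then have "C \<subseteq> side 1 \<union> side (-1)"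
    using sub by (force simp: side_def)
  then have "C \<subseteq> side 1 \<or> C \<subseteq> side (-1)"
    using connectedD[OF conn open_side[of 1] open_side[of "-1"]] by (fastforce simp: side_def)
  then obtain \<kappa> where \<kappa>: "\<kappa> = 1 \<or> \<kappa> = -1" and C_side: "C \<subseteq> side \<kappa>"
    by blast
  have absorb: "z + d \<in> C" if z: "z \<in> C" and d: "d \<in> orthant (\<kappa> * \<sigma>) (- \<kappa> * \<tau>)" for z d
  proof -
    let ?T = "closed_segment z (z + d)"
    have "?T \<subseteq> side \<kappa>"
    proof
      fix p assume "p \<in> ?T"
      then obtain t where "0 \<le> t" "p = z + t *\<^sub>R d"
        unfolding closed_segment_eq_line_image by auto
      then show "p \<in> side \<kappa>"
        using side_step[OF \<kappa>, of z "t *\<^sub>R d"] orthant_scale[OF d] z C_side by auto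
    qed
    then have "?T \<subseteq> C"
      using components_maximal[OF C, of ?T] side_avoids z by auto
    then show ?thesis by auto
  qed
  have "z + d \<in> closure C" if z: "z \<in> closure C" and d: "d \<in> orthant (\<kappa> * \<sigma>) (- \<kappa> * \<tau>)" for z d
  proof -
    have "(+) d ` C \<subseteq> C"
      using absorb[OF _ d] by (auto simp: add.commute)
    then have "(+) d ` closure C \<subseteq> closure C"
      using closure_mono closure_translation[of d C] by metis
    then show ?thesis
      using z by (auto simp: add.commute)
  qed
  then show ?thesis
    using \<kappa> st by (intro ortho_convex_if_absorbs_orthant[of "\<kappa> * \<sigma>" "- \<kappa> * \<tau>"]) auto
qed

lemma ortho_convex_staircase_halfplane:
  assumes "staircase_halfplane H"
  shows "ortho_convex H"
proof -
  obtain C where "C \<in> components (- frontier H)" "H = closure C"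
    using assms unfolding staircase_halfplane_def by blast
  moreover have "staircase_line (frontier H)"
    using assms unfolding staircase_halfplane_def by blast
  ultimately show ?thesis
    using staircase_line_structure ortho_convex_closure_component by metis
qed

section \<open>The characterisation\<close>

theorem theorem3:
  fixes S :: "(real \<times> real) set"
  assumes "path_connected S"
  shows "closed S \<and> ortho_convex S \<longleftrightarrow>
    (\<exists>\<F>. (\<forall>H\<in>\<F>. staircase_halfplane H) \<and> S = \<Inter>\<F>)"
proof
  assume S: "closed S \<and> ortho_convex S"
  let ?\<F> = "{H. staircase_halfplane H \<and> S \<subseteq> H}"
  have "p \<notin> \<Inter>?\<F>" if "p \<notin> S" for p
  proof -
    obtain \<sigma> \<tau> q where "\<sigma> \<noteq> 0" "\<tau> \<noteq> 0" and p: "p \<in> quadrant \<sigma> \<tau> q" and "S \<inter> quadrant \<sigma> \<tau> q = {}"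
      using separating_quadrant[of S p] path_connected_imp_connected[OF assms] S \<open>p \<notin> S\<close> by blast
    then have "- quadrant \<sigma> \<tau> q \<in> ?\<F>"
      using staircase_halfplane_quadrant_complement by blast
    with p show ?thesis by blast
  qed
  then have "S = \<Inter>?\<F>"
    by blast
  then show "\<exists>\<F>. (\<forall>H\<in>\<F>. staircase_halfplane H) \<and> S = \<Inter>\<F>"
    by (intro exI[of _ ?\<F>]) simp
next
  assume "\<exists>\<F>. (\<forall>H\<in>\<F>. staircase_halfplane H) \<and> S = \<Inter>\<F>"
  then obtain \<F> where \<F>: "\<And>H. H \<in> \<F> \<Longrightarrow> staircase_halfplane H" and S: "S = \<Inter>\<F>"
    by blast
  show "closed S \<and> ortho_convex S"
  proof
    show "closed S"
      unfolding S using \<F> by (intro closed_Inter) (simp add: staircase_halfplane_def)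
    show "ortho_convex S"
      unfolding S using \<F> by (intro ortho_convex_Inter ortho_convex_staircase_halfplane)
  qed
qed

end
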